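(* Let $q$ be an odd prime power with $q\ge5$, let $n\ge2$ with $q\equiv1\pmod{2n}$, and let $a,b\in\mathbb{F}_q^*$ with $a$ of multiplicative order $2n$. Put $z_i=ba^{i-1}$ and $x_i=(z_i-b)/(a+1)$ for $1\le i\le n$, and $\mathbf{O}_n=\{x_1,\ldots,x_n\}$. Let $F:\mathbb{F}_q\to\mathbb{F}_q$ be defined by $F(\delta)=(a+1)\delta+b$ for $\delta\notin\mathbf{O}_n$, $F(x_i)=ax_{i-1}+x_i+b$ for $2\le i\le n$, and $F(x_1)=0$. Then $|V_F|\ge q-n$, and every element of $\mathbb{F}_q$ has at most $2$ preimages under $F$.
   Context: $V_F=\{F(c):c\in\mathbb{F}_q\}$ denotes the value set of $F$. (Here $x_1=0$ and $x_n=-b/a$, and $F=f+x$ where $f$ is the permutation with $f=g$ off $\mathbf{O}_n$, $f(x_i)=g(x_{i-1})$ for $i\ge2$, $f(x_1)=g(x_n)=0$, $g(x)=ax+b$.) *)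

theory Defs
  imports "HOL-Number_Theory.Number_Theory" "HOL-Library.Cardinality"
begin

text \<open>Elements of infinite order get the value 0; in a finite field this affects only the
  element \<open>0\<close>.\<close>

definition mult_order :: "'a::monoid_mult \<Rightarrow> nat" where
  "mult_order a =
     (if \<exists>k>0. a ^ k = 1 then LEAST k. 0 < k \<and> a ^ k = 1 else 0)"

definition value_set :: "('a \<Rightarrow> 'b) \<Rightarrow> 'b set" where
  "value_set F = {F c | c. c \<in> UNIV}"

end

theory Submission
  imports Defs
begin

text \<open>On \<open>\<bbbF>\<^sub>q - O\<^sub>n\<close> the map \<open>F\<close> is affine with slope \<open>a + 1 \<noteq> 0\<close>, hence injective, which gives at
  least \<open>q - n\<close> values. On \<open>O\<^sub>n\<close> it is injective as well: \<open>F x\<^sub>1 = 0\<close>, and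
  \<open>F x\<^sub>i = 2ba\<^bsup>i-1\<^esup>/(a+1)\<close> for \<open>i \<ge> 2\<close>, where these powers of \<open>a\<close> are distinct and \<open>2 \<noteq> 0\<close> because
  \<open>a\<close> has even order. So every fibre has at most one point inside and one point outside \<open>O\<^sub>n\<close>.\<close>

lemma power_mult_order:
  assumes "mult_order a > 0"
  shows "a ^ mult_order a = 1"
proof -
  \<comment> \<open>Positivity rules out the default value 0, so the \<open>LEAST\<close> ranges
    over a nonempty set.\<close>
  have ex: "\<exists>k>0. a ^ k = 1"
    using assms by (auto simp: mult_order_def split: if_splits)
  then show ?thesis
    using LeastI_ex[of "\<lambda>k. 0 < k \<and> a ^ k = 1"] by (simp add: mult_order_def)
qed

lemma power_neq_one_if_less_mult_order:
  assumes "0 < k" "k < mult_order a"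
  shows "a ^ k \<noteq> 1"
proof
  assume "a ^ k = 1"
  then have "mult_order a \<le> k"
    using assms(1) by (auto simp: mult_order_def intro: Least_le)
  with assms(2) show False by simp
qed

lemma inj_on_power_mult_order:
  fixes a :: "'a :: field"
  assumes "a \<noteq> 0"
  shows "inj_on (\<lambda>k. a ^ k) {..<mult_order a}"
proof (rule linorder_inj_onI)
  fix i j assume ij: "i < j" "i \<in> {..<mult_order a}" "j \<in> {..<mult_order a}"
  show "a ^ i \<noteq> a ^ j"
  proof
    assume "a ^ i = a ^ j"
    also have "a ^ j = a ^ i * a ^ (j - i)"
      using ij by (simp flip: power_add)
    finally have "a ^ (j - i) = 1"
      using assms by simp
    moreover have "a ^ (j - i) \<noteq> 1"
      using ij by (intro power_neq_one_if_less_mult_order) auto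
    ultimately show False by contradiction
  qed
qed auto

text \<open>In characteristic 2, squaring is additive, so
  \<open>(a ^ n - 1) ^ 2 = a ^ (2 * n) - 1 = 0\<close>. This forces \<open>a ^ n = 1\<close>,
  contradicting the minimality of the order.\<close>

lemma two_neq_zero_if_even_mult_order:
  fixes a :: "'a :: field"
  assumes "mult_order a = 2 * n" "n > 0"
  shows "(2 :: 'a) \<noteq> 0"
proof
  assume two: "(2 :: 'a) = 0"
  have "(a ^ n - 1) ^ 2 = a ^ (2 * n) - 2 * a ^ n + 1"
    by (simp add: power2_diff power_even_eq)
  also have "\<dots> = 2 - 2 * a ^ n"
    using power_mult_order[of a] assms by simp
  also have "\<dots> = 0"
    using two by simp
  finally have "a ^ n = 1" by simp
  then show False
    using power_neq_one_if_less_mult_order[of n a] assms by simp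
qed

lemma card_fibre_le_2:
  fixes F :: "'a :: finite \<Rightarrow> 'b"
  assumes "inj_on F S" "inj_on F (- S)"
  shows "card (F -` {y}) \<le> 2"
proof -
  have one: "card (F -` {y} \<inter> T) \<le> 1" if "inj_on F T" for T
    using card_vimage_inj_on_le[OF that, of "{y}"] by simp
  have "F -` {y} = (F -` {y} \<inter> S) \<union> (F -` {y} \<inter> - S)" by auto
  then have "card (F -` {y}) \<le> card (F -` {y} \<inter> S) + card (F -` {y} \<inter> - S)"
    using card_Un_le[of "F -` {y} \<inter> S" "F -` {y} \<inter> - S"] by simp
  also have "\<dots> \<le> 2"
    using one[OF assms(1)] one[OF assms(2)] by simp
  finally show ?thesis .
qed

theorem theorem9:
  fixes q n :: nat
    and a b :: "'a :: {field, finite}"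
    and z x :: "nat \<Rightarrow> 'a"
    and On :: "'a set"
    and F :: "'a \<Rightarrow> 'a"
  assumes "CARD('a) = q"
    and "primepow q" and "odd q" and "q \<ge> 5"
    and "n \<ge> 2" and "[q = 1] (mod 2 * n)"
    and "a \<noteq> 0" and "b \<noteq> 0" and "mult_order a = 2 * n"
    and "\<forall>i\<in>{1..n}. z i = b * a ^ (i - 1)"
    and "\<forall>i\<in>{1..n}. x i = (z i - b) / (a + 1)"
    and "On = x ` {1..n}"
    and "\<forall>d. d \<notin> On \<longrightarrow> F d = (a + 1) * d + b"
    and "\<forall>i\<in>{2..n}. F (x i) = a * x (i - 1) + x i + b"
    and "F (x 1) = 0"
  shows "card (value_set F) \<ge> q - n \<and> (\<forall>y. card (F -` {y}) \<le> 2)"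
proof -
  note n = \<open>n \<ge> 2\<close> and ord = \<open>mult_order a = 2 * n\<close>
  \<comment> \<open>Since \<open>n \<ge> 2\<close>, the order of \<open>a\<close> is at least 4,
    whereas \<open>- 1\<close> squares to 1.\<close>
  have a1: "a + 1 \<noteq> 0"
  proof
    assume "a + 1 = 0"
    then have "a = - 1" by (simp add: eq_neg_iff_add_eq_0)
    then have "a ^ 2 = 1" by simp
    then show False
      using power_neq_one_if_less_mult_order[of 2 a] n ord by simp
  qed
  have two: "(2 :: 'a) \<noteq> 0"
    using two_neq_zero_if_even_mult_order[OF ord] n by simp
  have x: "x i = (b * a ^ (i - 1) - b) / (a + 1)" if "i \<in> {1..n}" for i
    using that assms(10,11) by simp
  \<comment> \<open>As \<open>a * z (i - 1) = z i\<close>, the first two summands of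
    \<open>F (x i)\<close> add up to \<open>2 * z i / (a + 1) - b\<close>, and the final
    \<open>+ b\<close> cancels the constant.\<close>
  have Fx: "F (x i) = 2 * b / (a + 1) * a ^ (i - 1)" if i: "i \<in> {2..n}" for i
  proof -
    \<comment> \<open>Here \<open>i \<ge> 2\<close> matters: the natural number subtraction
      \<open>i - 1 - 1\<close> does not truncate.\<close>
    have pow: "a * a ^ (i - 1 - 1) = a ^ (i - 1)"
      using i by (simp flip: power_Suc add: Suc_diff_Suc numeral_2_eq_2)
    have "F (x i) = a * x (i - 1) + x i + b"
      using assms(14) i by blast
    also have "\<dots> = (b * (a * a ^ (i - 1 - 1)) - a * b) / (a + 1) + (b * a ^ (i - 1) - b) / (a + 1) + b"
      using i by (subst (1 2) x) (auto simp: algebra_simps)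
    also have "\<dots> = 2 * b / (a + 1) * a ^ (i - 1)"
      unfolding pow using a1 by (simp add: divide_simps) (simp add: algebra_simps)
    finally show ?thesis .
  qed
  have inj_Fx: "inj_on (F \<circ> x) {1..n}"
  proof (rule linorder_inj_onI)
    fix i j assume ij: "i < j" "i \<in> {1..n}" "j \<in> {1..n}"
    then have Fj: "F (x j) = 2 * b / (a + 1) * a ^ (j - 1)" by (intro Fx) auto
    show "(F \<circ> x) i \<noteq> (F \<circ> x) j"
    \<comment> \<open>Because \<open>i < j\<close>, only \<open>i\<close> can be the exceptional
      index 1, where the value is 0 while \<open>F (x j)\<close> is a product of nonzero
      factors.\<close>
    proof (cases "i = 1")
      case True
      then show ?thesis
        using Fj assms(7,8,15) a1 two by simp
    next
      case False
      then have "F (x i) = 2 * b / (a + 1) * a ^ (i - 1)"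
        using ij by (intro Fx) auto
      \<comment> \<open>Both exponents are below \<open>n\<close>, hence below the order
        \<open>2 * n\<close>.\<close>
      moreover have "a ^ (i - 1) \<noteq> a ^ (j - 1)"
        using inj_on_contraD[OF inj_on_power_mult_order[OF \<open>a \<noteq> 0\<close>], of "i - 1" "j - 1"] ij ord by simp
      ultimately show ?thesis
        using Fj assms(8) a1 two by simp
    qed
  qed auto
  then have inj_in: "inj_on F On"
    unfolding \<open>On = x ` {1..n}\<close> by (rule inj_on_imageI)
  have inj_out: "inj_on F (- On)"
    using assms(13) a1 by (auto intro!: inj_onI)
  \<comment> \<open>The bound \<open>card On \<le> n\<close> suffices here, since subtraction
    reverses it.\<close>
  have "q - n \<le> q - card On"
    using card_image_le[of "{1..n}" x] \<open>On = x ` {1..n}\<close> by simp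
  also have "\<dots> = card (F ` (- On))"
    using inj_out \<open>CARD('a) = q\<close> by (simp add: card_image Compl_eq_Diff_UNIV card_Diff_subset)
  also have "\<dots> \<le> card (value_set F)"
    by (intro card_mono) (auto simp: value_set_def)
  finally show ?thesis
    using card_fibre_le_2[OF inj_in inj_out] by blast
qed

end
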